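(* For every integer $r\ge4$, the Balaban index of the third type of triangular hex derived network $THDN3(r)$ is $$J(THDN3(r))=\frac{6-13r+7r^2}{40\,(8-14r+7r^2)}\Big(159+180\sqrt2-36\sqrt5-90\sqrt{10}+\big(-107-150\sqrt2+12\sqrt5+54\sqrt{10}\big)r+10\,(5+3\sqrt2)\,r^2\Big).$$
   Context: All graphs are finite, simple and undirected; $\kappa(p)$ denotes the degree of a vertex $p$ in a graph $G$. Triangular mesh of dimension $r$: the graph whose vertices are the triples $(x,y,z)$ of nonnegative integers with $x+y+z=r-1$, two vertices being adjacent iff their difference is a permutation of $(1,-1,0)$ (a triangular piece of the triangular lattice with $r$ vertices on each side). Third type of triangular hex derived network $THDN3(r)$: obtained from the triangular mesh of dimension $r$ by replacing each $K_3$ subgraph (triangle) by a planar octahedron, once. That is, for each triangle with vertices $a,b,c$, all edges of the triangle are kept, three new vertices $u_{ab},u_{bc},u_{ca}$ (private to that triangle) are added, the new vertices are made pairwise adjacent, and $u_{ab}$ is joined to $a$ and $b$, $u_{bc}$ to $b$ and $c$, $u_{ca}$ to $c$ and $a$. It has $\frac{7r^2-11r+6}{2}$ vertices. Balaban index (in the sense used here): for a graph $G$, $$J(G)=\frac{|E(G)|}{|E(G)|-|V(G)|+2}\sum_{pq\in E(G)}\frac{1}{\sqrt{\kappa(p)\,\kappa(q)}}.$$ *)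

theory Defs
  imports Complex_Main
begin

record 'a ugraph =
  verts :: "'a set"
  edges :: "'a set set"

definition finite_simple_graph :: "'a ugraph \<Rightarrow> bool" where
  "finite_simple_graph G \<longleftrightarrow> finite (verts G) \<and>
     (\<forall>e \<in> edges G. \<exists>u v. u \<in> verts G \<and> v \<in> verts G \<and> u \<noteq> v \<and> e = {u, v})"

definition vertex_degree :: "'a ugraph \<Rightarrow> 'a \<Rightarrow> nat" where
  "vertex_degree G v = card {e \<in> edges G. v \<in> e}"

text \<open>An edge is a two-element set \<open>{p, q}\<close>, so the product over its elements is
  \<open>vertex_degree G p * vertex_degree G q\<close>.\<close>

definition balaban_index :: "'a ugraph \<Rightarrow> real" where
  "balaban_index G =
     real (card (edges G)) / (real (card (edges G)) - real (card (verts G)) + 2) *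
     (\<Sum>e \<in> edges G. 1 / sqrt (\<Prod>p \<in> e. real (vertex_degree G p)))"

definition mesh_adj :: "nat \<times> nat \<times> nat \<Rightarrow> nat \<times> nat \<times> nat \<Rightarrow> bool" where
  "mesh_adj = (\<lambda>(x, y, z) (x', y', z').
     (int x - int x', int y - int y', int z - int z') \<in>
       {(1, -1, 0), (1, 0, -1), (-1, 1, 0), (0, 1, -1), (-1, 0, 1), (0, -1, 1)})"

text \<open>The side condition is written \<open>x + y + z + 1 = r\<close> to avoid truncated subtraction.\<close>

definition triangular_mesh :: "nat \<Rightarrow> (nat \<times> nat \<times> nat) ugraph" where
  "triangular_mesh r =
     (let V = {(x, y, z). x + y + z + 1 = r}
      in \<lparr>verts = V, edges = {{u, v} | u v. u \<in> V \<and> v \<in> V \<and> mesh_adj u v}\<rparr>)"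

definition triangles :: "'a ugraph \<Rightarrow> 'a set set" where
  "triangles G = {T. T \<subseteq> verts G \<and> card T = 3 \<and>
     (\<forall>a \<in> T. \<forall>b \<in> T. a \<noteq> b \<longrightarrow> {a, b} \<in> edges G)}"

text \<open>\<open>New T e\<close> is the new vertex on the side \<open>e\<close> of the triangle \<open>T\<close>; recording \<open>T\<close> makes
  it private to that triangle even though \<open>e\<close> may be a side of two triangles.\<close>

datatype 'a octa_vertex = Old 'a | New "'a set" "'a set"

definition sides :: "'a set \<Rightarrow> 'a set set" where
  "sides T = {e. e \<subseteq> T \<and> card e = 2}"

definition octahedral_replacement :: "'a ugraph \<Rightarrow> 'a octa_vertex ugraph" where
  "octahedral_replacement G = \<lparr>
     verts = Old ` verts G \<union> {New T e | T e. T \<in> triangles G \<and> e \<in> sides T},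
     edges = {{Old a, Old b} | a b. {a, b} \<in> edges G}
       \<union> {{New T e, New T e'} | T e e'.
            T \<in> triangles G \<and> e \<in> sides T \<and> e' \<in> sides T \<and> e \<noteq> e'}
       \<union> {{New T e, Old a} | T e a. T \<in> triangles G \<and> e \<in> sides T \<and> a \<in> e}\<rparr>"

definition THDN3 :: "nat \<Rightarrow> (nat \<times> nat \<times> nat) octa_vertex ugraph" where
  "THDN3 r = octahedral_replacement (triangular_mesh r)"

lemma finite_simple_graph_triangular_mesh: "finite_simple_graph (triangular_mesh r)"
proof -
  have "{(x, y, z). x + y + z + 1 = r} \<subseteq> {..r} \<times> {..r} \<times> {..r}"
    by auto
  then have "finite {(x, y, z). x + y + z + 1 = r}"
    by (rule finite_subset) auto
  then show ?thesis
    unfolding finite_simple_graph_def triangular_mesh_def Let_def mesh_adj_def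
    by fastforce
qed

lemma finite_simple_graph_octahedral_replacement:
  assumes "finite_simple_graph G"
  shows "finite_simple_graph (octahedral_replacement G)"
proof -
  have fin: "finite (verts G)"
    and edge: "\<And>e. e \<in> edges G \<Longrightarrow> \<exists>u v. u \<in> verts G \<and> v \<in> verts G \<and> u \<noteq> v \<and> e = {u, v}"
    using assms by (auto simp: finite_simple_graph_def)
  have "{New T e | T e. T \<in> triangles G \<and> e \<in> sides T}
      \<subseteq> (\<lambda>(T, e). New T e) ` (Pow (verts G) \<times> Pow (verts G))"
    by (force simp: triangles_def sides_def)
  then have "finite {New T e | T e. T \<in> triangles G \<and> e \<in> sides T}"
    by (rule finite_subset) (use fin in auto)
  then have 1: "finite (verts (octahedral_replacement G))"
    using fin by (simp add: octahedral_replacement_def)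
  have old: "a \<in> verts G \<and> b \<in> verts G \<and> a \<noteq> b" if "{a, b} \<in> edges G" for a b
    using edge[OF that] by (auto simp: doubleton_eq_iff)
  have side: "a \<in> verts G" if "T \<in> triangles G" "e \<in> sides T" "a \<in> e" for T e a
    using that by (auto simp: triangles_def sides_def)
  have 2: "\<exists>u v. u \<in> verts (octahedral_replacement G) \<and> v \<in> verts (octahedral_replacement G)
      \<and> u \<noteq> v \<and> d = {u, v}" if "d \<in> edges (octahedral_replacement G)" for d
    using that
    unfolding octahedral_replacement_def ugraph.select_convs
  proof (elim UnE CollectE exE conjE)
    fix a b
    assume "d = {Old a, Old b}" "{a, b} \<in> edges G"
    then show "\<exists>u v. u \<in> (Old ` verts G \<union> {New T e | T e. T \<in> triangles G \<and> e \<in> sides T}) \<and> v \<in> (Old ` verts G \<union> {New T e | T e. T \<in> triangles G \<and> e \<in> sides T}) \<and> u \<noteq> v \<and> d = {u, v}"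
      using old[of a b] by (intro exI[of _ "Old a"] exI[of _ "Old b"]) simp
  next
    fix T e e'
    assume "d = {New T e, New T e'}" "T \<in> triangles G" "e \<in> sides T" "e' \<in> sides T" "e \<noteq> e'"
    then show "\<exists>u v. u \<in> (Old ` verts G \<union> {New T e | T e. T \<in> triangles G \<and> e \<in> sides T}) \<and> v \<in> (Old ` verts G \<union> {New T e | T e. T \<in> triangles G \<and> e \<in> sides T}) \<and> u \<noteq> v \<and> d = {u, v}"
      by (intro exI[of _ "New T e"] exI[of _ "New T e'"]) simp
  next
    fix T e a
    assume "d = {New T e, Old a}" "T \<in> triangles G" "e \<in> sides T" "a \<in> e"
    then show "\<exists>u v. u \<in> (Old ` verts G \<union> {New T e | T e. T \<in> triangles G \<and> e \<in> sides T}) \<and> v \<in> (Old ` verts G \<union> {New T e | T e. T \<in> triangles G \<and> e \<in> sides T}) \<and> u \<noteq> v \<and> d = {u, v}"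
      using side[of T e a] by (intro exI[of _ "New T e"] exI[of _ "Old a"]) simp
  qed
  show ?thesis
    using 1 2 by (simp add: finite_simple_graph_def)
qed

lemma finite_simple_graph_THDN3: "finite_simple_graph (THDN3 r)"
  unfolding THDN3_def
  by (intro finite_simple_graph_octahedral_replacement finite_simple_graph_triangular_mesh)

end

theory Submission
  imports Defs
begin

text \<open>The network splits into its mesh edges, three edges among the new vertices of each
  triangle, and six edges joining these to its corners. The new vertices all have degree 4, and an
  old vertex has its mesh degree plus two for every triangle through it. So the Balaban sum of an
  octahedral replacement is determined by the base graph
  (\<open>edge_weight_octahedral_replacement\<close>): a sum over its edges, \<open>3/4\<close> per triangle, and a sum
  over the corners of its triangles.

  In the triangular mesh every edge lies on exactly one upward triangle, so sums over edges become
  sums over upward triangles. Upward and downward triangles are indexed by their coordinatewise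
  minima, which are again the lattice points of simplices \<open>x + y + z = m\<close>, one and two sizes
  smaller than that of the mesh vertices
  (\<open>sum_edges_mesh\<close>, \<open>sum_triangles_mesh\<close>). Counting the triangles through a vertex shows that
  its degree in the network is 4, 10 or 18 according to whether two, one or none of its
  coordinates vanish.

  Hence every sum in question is a sum over the lattice points of a simplex of a function that
  only depends on which coordinates are zero, and such a sum is evaluated by counting the corners,
  the points inside each side and the interior points (\<open>sum_simplex_zero_pattern\<close>). The
  degree products 16, 40, 72, 100, 180 and 324 that occur account for the square roots of 2, 5 and
  10 in the result.\<close>

section \<open>Pairs in a three-element set\<close>

lemma sides_triple:
  assumes "a \<noteq> b" "b \<noteq> c" "a \<noteq> c"
  shows "sides {a, b, c} = {{a, b}, {b, c}, {a, c}}"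
  using assms by (auto simp: sides_def card_2_iff doubleton_eq_iff)

lemma card_3_obtain:
  assumes "card T = 3"
  obtains a b c where "T = {a, b, c}" "a \<noteq> b" "b \<noteq> c" "a \<noteq> c"
  using assms by (auto simp: card_3_iff)

lemma sum_sides_triple:
  fixes f :: "'a set \<Rightarrow> 'b::comm_monoid_add"
  assumes "a \<noteq> b" "b \<noteq> c" "a \<noteq> c"
  shows "(\<Sum>e\<in>sides {a, b, c}. f e) = f {a, b} + f {b, c} + f {a, c}"
proof -
  have "{a, b} \<noteq> {b, c}" "{b, c} \<noteq> {a, c}" "{a, b} \<noteq> {a, c}"
    using assms by (auto simp: doubleton_eq_iff)
  then show ?thesis
    using assms by (simp add: sides_triple add.assoc)
qed

lemma card_sides:
  assumes "card T = 3"
  shows "card (sides T) = 3"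
proof -
  from assms obtain a b c where T: "T = {a, b, c}" "a \<noteq> b" "b \<noteq> c" "a \<noteq> c"
    by (rule card_3_obtain)
  have "card (sides T) = (\<Sum>e\<in>sides T. 1)" by simp
  also have "\<dots> = 3" unfolding T(1) by (subst sum_sides_triple) (use T in auto)
  finally show ?thesis .
qed

text \<open>Each element of a three-element set lies on two of its sides. Degrees in the
  mesh and in the network are both counted with this fact.\<close>

lemma sum_sides_elements:
  fixes f :: "'a \<Rightarrow> 'b::comm_semiring_1"
  assumes "card T = 3"
  shows "(\<Sum>e\<in>sides T. \<Sum>a\<in>e. f a) = 2 * (\<Sum>a\<in>T. f a)"
proof -
  from assms obtain a b c where T: "T = {a, b, c}" "a \<noteq> b" "b \<noteq> c" "a \<noteq> c"
    by (rule card_3_obtain)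
  show ?thesis
    unfolding T(1) using T(2-4) by (simp add: sum_sides_triple algebra_simps mult_2_right)
qed

lemma finite_sides: "finite T \<Longrightarrow> finite (sides T)"
  by (simp add: sides_def)

lemma sides_finite_mem: "e \<in> sides T \<Longrightarrow> finite e"
  by (auto simp: sides_def card_2_iff)

lemma sum_of_bool_eq:
  "finite S \<Longrightarrow> (\<Sum>b\<in>S. of_bool (b = a)) = (of_bool (a \<in> S) :: nat)"
  by (simp add: of_bool_def)

section \<open>Degrees as sums over edges\<close>

lemma finite_edges:
  assumes "finite_simple_graph G"
  shows "finite (edges G)"
proof -
  have "edges G \<subseteq> Pow (verts G)" "finite (verts G)"
    using assms by (auto simp: finite_simple_graph_def)
  then show ?thesis by (meson finite_Pow_iff finite_subset)
qed

lemma finite_triangles: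
  assumes "finite_simple_graph G"
  shows "finite (triangles G)"
proof -
  have "triangles G \<subseteq> Pow (verts G)" "finite (verts G)"
    using assms by (auto simp: finite_simple_graph_def triangles_def)
  then show ?thesis by (meson finite_Pow_iff finite_subset)
qed

lemma card_triangle: "T \<in> triangles G \<Longrightarrow> card T = 3"
  by (simp add: triangles_def)

lemma vertex_degree_eq_sum:
  assumes "finite_simple_graph G"
  shows "vertex_degree G v = (\<Sum>e\<in>edges G. of_bool (v \<in> e))"
  using finite_edges[OF assms]
  by (simp add: vertex_degree_def of_bool_def sum.If_cases Int_def)

section \<open>Octahedral replacement\<close>

text \<open>The three parametrizations turn sums over edges into iterated sums. The edges among
  the new vertices of a triangle \<open>T\<close> are the pairs of sides of \<open>T\<close>, that is, the sides of the
  three-element set \<open>sides T\<close>.\<close>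

lemma edges_octahedral_replacement:
  assumes "finite_simple_graph G"
  shows "edges (octahedral_replacement G) =
    (\<lambda>e. Old ` e) ` edges G
    \<union> (\<lambda>(T, d). New T ` d) ` (SIGMA T:triangles G. sides (sides T))
    \<union> (\<lambda>(T, e, a). {New T e, Old a}) ` (SIGMA T:triangles G. SIGMA e:sides T. e)"
proof -
  have 1: "{{Old a, Old b} | a b. {a, b} \<in> edges G} = (\<lambda>e. Old ` e) ` edges G"
  proof (intro set_eqI iffI)
    fix d :: "'a octa_vertex set"
    assume "d \<in> (\<lambda>e. Old ` e) ` edges G"
    then obtain e where e: "e \<in> edges G" "d = Old ` e" by blast
    then obtain a b where "e = {a, b}"
      using assms unfolding finite_simple_graph_def by blast
    then show "d \<in> {{Old a, Old b} | a b. {a, b} \<in> edges G}" using e by auto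
  qed (auto intro: rev_image_eqI)
  have 2: "{{New T e, New T e'} | T e e'.
            T \<in> triangles G \<and> e \<in> sides T \<and> e' \<in> sides T \<and> e \<noteq> e'}
     = (\<lambda>(T, d). New T ` d) ` (SIGMA T:triangles G. sides (sides T))" (is "?L = ?R")
  proof (intro set_eqI iffI)
    fix d assume "d \<in> ?L"
    then obtain T e e' where "d = New T ` {e, e'}" "T \<in> triangles G"
      "e \<in> sides T" "e' \<in> sides T" "e \<noteq> e'" by auto
    moreover have "{e, e'} \<in> sides (sides T)"
      unfolding sides_def[of "sides T"] using calculation by auto
    ultimately show "d \<in> ?R" by (intro image_eqI[of _ _ "(T, {e, e'})"]) auto
  next
    fix d assume "d \<in> ?R"
    then obtain T s where *: "d = New T ` s" "T \<in> triangles G" "s \<in> sides (sides T)" by auto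
    then obtain e e' where "s = {e, e'}" "e \<noteq> e'" "e \<in> sides T" "e' \<in> sides T"
      unfolding sides_def[of "sides T"] by (auto simp: card_2_iff)
    then show "d \<in> ?L" using * by auto
  qed
  have 3: "{{New T e, Old a} | T e a. T \<in> triangles G \<and> e \<in> sides T \<and> a \<in> e}
    = (\<lambda>(T, e, a). {New T e, Old a}) ` (SIGMA T:triangles G. SIGMA e:sides T. e)" (is "?L = ?R")
  proof (intro set_eqI iffI)
    fix d assume "d \<in> ?L"
    then obtain T e a where "d = {New T e, Old a}" "T \<in> triangles G" "e \<in> sides T" "a \<in> e"
      by blast
    then show "d \<in> ?R" by (intro image_eqI[of _ _ "(T, e, a)"]) auto
  qed auto
  show ?thesis
    unfolding octahedral_replacement_def ugraph.select_convs 1 2 3 ..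
qed

lemma sum_edges_octahedral_replacement:
  fixes f :: "'a octa_vertex set \<Rightarrow> 'b::comm_monoid_add"
  assumes G: "finite_simple_graph G"
  shows "(\<Sum>d\<in>edges (octahedral_replacement G). f d) =
    (\<Sum>e\<in>edges G. f (Old ` e))
    + (\<Sum>T\<in>triangles G. \<Sum>d\<in>sides (sides T). f (New T ` d))
    + (\<Sum>T\<in>triangles G. \<Sum>e\<in>sides T. \<Sum>a\<in>e. f {New T e, Old a})"
proof -
  let ?A = "(\<lambda>e. Old ` e) ` edges G :: 'a octa_vertex set set"
  let ?SB = "SIGMA T:triangles G. sides (sides T)"
  let ?B = "(\<lambda>(T, d). New T ` d) ` ?SB :: 'a octa_vertex set set"
  let ?SC = "SIGMA T:triangles G. SIGMA e:sides T. e"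
  let ?C = "(\<lambda>(T, e, a). {New T e, Old a}) ` ?SC :: 'a octa_vertex set set"
  have fT: "finite (triangles G)" by (rule finite_triangles[OF G])
  have fin_T: "finite T" if "T \<in> triangles G" for T
    using card_triangle[OF that] card.infinite by fastforce
  have fsB: "\<forall>T\<in>triangles G. finite (sides (sides T))"
    using fin_T by (simp add: finite_sides)
  have fsC: "\<forall>T\<in>triangles G. finite (SIGMA e:sides T. e)"
    using fin_T by (auto intro!: finite_SigmaI finite_sides dest: sides_finite_mem)
  have fA: "finite ?A" using finite_edges[OF G] by simp
  have fB: "finite ?B" using fT fsB by auto
  have fC: "finite ?C" by (rule finite_imageI, rule finite_SigmaI[OF fT], rule fsC[rule_format])
  have neA: "e \<noteq> {}" if "e \<in> edges G" for e
    using G that unfolding finite_simple_graph_def by blast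
  have neB: "d \<noteq> {}" if "d \<in> sides S" for d and S :: "'c set"
    using that by (auto simp: sides_def)
  have AB: "?A \<inter> ?B = {}" using neA neB by fastforce
  have ABC: "(?A \<union> ?B) \<inter> ?C = {}" by (auto simp: set_eq_iff image_iff)
  have iA: "inj_on (\<lambda>e. Old ` e) (edges G)"
    by (auto simp: inj_on_def inj_image_eq_iff inj_def)
  have iB: "inj_on (\<lambda>(T, d). New T ` d) ?SB"
  proof (rule inj_onI, clarify)
    fix T d T' d'
    assume d: "d \<in> sides (sides T)" and eq: "New T ` d = New T' ` d'"
    obtain x where "x \<in> d" using neB[OF d] by blast
    then have "New T x \<in> New T' ` d'" using eq by blast
    then have T: "T = T'" by auto
    moreover have "inj (New T)" by (auto simp: inj_def)
    ultimately show "T = T' \<and> d = d'" using eq by (simp add: inj_image_eq_iff)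
  qed
  have iC: "inj_on (\<lambda>(T, e, a). {New T e, Old a}) ?SC"
    by (auto simp: inj_on_def doubleton_eq_iff)
  have "(\<Sum>d\<in>edges (octahedral_replacement G). f d) = sum f ?A + sum f ?B + sum f ?C"
    unfolding edges_octahedral_replacement[OF G]
    using fA fB fC AB ABC by (simp add: sum.union_disjoint)
  also have "sum f ?A = (\<Sum>e\<in>edges G. f (Old ` e))"
    using iA by (simp add: sum.reindex)
  also have "sum f ?B = (\<Sum>T\<in>triangles G. \<Sum>d\<in>sides (sides T). f (New T ` d))"
    unfolding sum.reindex[OF iB] sum.Sigma[OF fT fsB] by (simp add: o_def case_prod_beta)
  also have "sum f ?C = (\<Sum>T\<in>triangles G. \<Sum>(e, a)\<in>(SIGMA e:sides T. e). f {New T e, Old a})"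
    unfolding sum.reindex[OF iC] sum.Sigma[OF fT fsC] by (simp add: o_def case_prod_beta)
  also have "\<dots> = (\<Sum>T\<in>triangles G. \<Sum>e\<in>sides T. \<Sum>a\<in>e. f {New T e, Old a})"
    by (intro sum.cong refl sum.Sigma[symmetric]) (auto intro: finite_sides fin_T sides_finite_mem)
  finally show ?thesis .
qed

lemma card_edges_octahedral_replacement:
  assumes G: "finite_simple_graph G"
  shows "card (edges (octahedral_replacement G)) = card (edges G) + 9 * card (triangles G)"
proof -
  have "(\<Sum>e\<in>sides T. \<Sum>a\<in>e. 1) = (6::nat)" if "T \<in> triangles G" for T
    using sum_sides_elements[of T "\<lambda>_. 1::nat"] card_triangle[OF that] by simp
  moreover have "card (sides (sides T)) = 3" if "T \<in> triangles G" for T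
    using that by (simp add: card_sides card_triangle)
  ultimately show ?thesis
    using sum_edges_octahedral_replacement[OF G, of "\<lambda>_. 1::nat"]
    by simp
qed

lemma card_verts_octahedral_replacement:
  assumes G: "finite_simple_graph G"
  shows "card (verts (octahedral_replacement G)) = card (verts G) + 3 * card (triangles G)"
proof -
  let ?S = "SIGMA T:triangles G. sides T"
  let ?N = "(\<lambda>(T, e). New T e) ` ?S"
  have fT: "finite (triangles G)" by (rule finite_triangles[OF G])
  have fs: "\<forall>T\<in>triangles G. finite (sides T)"
    by (metis card_sides card_triangle card.infinite zero_neq_numeral)
  have "verts (octahedral_replacement G) = Old ` verts G \<union> ?N"
    by (auto simp: octahedral_replacement_def)
  moreover have "card (Old ` verts G) = card (verts G)"
    by (rule card_image) (simp add: inj_on_def)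
  moreover have "card ?N = 3 * card (triangles G)"
  proof -
    have "card ?N = card ?S" by (rule card_image) (auto simp: inj_on_def)
    also have "\<dots> = (\<Sum>T\<in>triangles G. card (sides T))" using fT fs by simp
    also have "\<dots> = (\<Sum>T\<in>triangles G. 3)"
      by (intro sum.cong refl) (simp add: card_sides card_triangle)
    finally show ?thesis by simp
  qed
  moreover have "finite (verts G)" using G by (simp add: finite_simple_graph_def)
  moreover have "finite ?N" using fT fs by auto
  moreover have "Old ` verts G \<inter> ?N = {}" by auto
  ultimately show ?thesis by (simp add: card_Un_disjoint)
qed

text \<open>In each triangle through \<open>a\<close>, the new vertices on the two sides that contain \<open>a\<close> are
  joined to it.\<close>

lemma vertex_degree_Old:
  assumes G: "finite_simple_graph G"
  shows "vertex_degree (octahedral_replacement G) (Old a) =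
    vertex_degree G a + 2 * (\<Sum>T\<in>triangles G. of_bool (a \<in> T))"
proof -
  have ind: "(\<Sum>b\<in>T. of_bool (b = a)) = (of_bool (a \<in> T) :: nat)" if "T \<in> triangles G" for T
  proof -
    have "finite T" using card_triangle[OF that] card.infinite by fastforce
    then show ?thesis by (rule sum_of_bool_eq)
  qed
  have "(\<Sum>e\<in>sides T. \<Sum>b\<in>e. of_bool (Old a \<in> {New T e, Old b})) = 2 * (of_bool (a \<in> T) :: nat)"
    if "T \<in> triangles G" for T
    using sum_sides_elements[of T "\<lambda>b. of_bool (b = a) :: nat"] card_triangle[OF that] ind[OF that]
    by (simp add: eq_commute[of a])
  moreover have "(Old a \<in> Old ` e) = (a \<in> e)" "Old a \<notin> New T ` d" for e T d by auto
  ultimately show ?thesis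
    by (simp add: vertex_degree_eq_sum[OF finite_simple_graph_octahedral_replacement[OF G]]
        vertex_degree_eq_sum[OF G] sum_edges_octahedral_replacement[OF G] sum_distrib_left)
qed

text \<open>Two neighbours are the other new vertices of the same triangle, two are the ends of the
  side.\<close>

lemma vertex_degree_New:
  assumes G: "finite_simple_graph G" and T: "T \<in> triangles G" and e: "e \<in> sides T"
  shows "vertex_degree (octahedral_replacement G) (New T e) = 4"
proof -
  have fT: "finite (triangles G)" by (rule finite_triangles[OF G])
  have cT: "card T = 3" by (rule card_triangle[OF T])
  have fs: "finite (sides T)" by (metis card_sides cT card.infinite zero_neq_numeral)
  have old: "New T e \<notin> Old ` d" for d by auto
  have "(\<Sum>T'\<in>triangles G. \<Sum>d\<in>sides (sides T'). of_bool (New T e \<in> New T' ` d)) =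
     (\<Sum>T'\<in>triangles G. if T' = T then \<Sum>d\<in>sides (sides T). of_bool (e \<in> d) else (0::nat))"
    by (intro sum.cong refl) (simp add: image_iff)
  also have "\<dots> = (\<Sum>d\<in>sides (sides T). of_bool (e \<in> d))"
    using fT T by simp
  also have "\<dots> = (\<Sum>d\<in>sides (sides T). \<Sum>x\<in>d. of_bool (x = e))"
    by (intro sum.cong refl) (simp add: sum_of_bool_eq sides_finite_mem)
  also have "\<dots> = 2"
    using fs e cT by (simp add: sum_sides_elements card_sides of_bool_def)
  finally have new: "(\<Sum>T'\<in>triangles G. \<Sum>d\<in>sides (sides T').
      of_bool (New T e \<in> New T' ` d)) = (2::nat)" .
  have "(\<Sum>T'\<in>triangles G. \<Sum>e'\<in>sides T'. \<Sum>a\<in>e'. of_bool (New T e \<in> {New T' e', Old a})) =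
     (\<Sum>T'\<in>triangles G. if T' = T then \<Sum>e'\<in>sides T. if e' = e then card e else 0 else (0::nat))"
    by (intro sum.cong refl) (auto intro!: sum.cong)
  also have "\<dots> = 2"
    using fT T fs e by (simp add: sides_def)
  finally show ?thesis
    using new old
    by (simp add: vertex_degree_eq_sum[OF finite_simple_graph_octahedral_replacement[OF G]]
        sum_edges_octahedral_replacement[OF G])
qed

text \<open>The last summand collects the edges between new and old vertices. Every corner \<open>a\<close> of a
  triangle meets two of them, each of weight \<open>1 / sqrt (4 * D a)\<close>; the factor \<open>sqrt 4\<close> cancels
  the two.\<close>

lemma edge_weight_octahedral_replacement:
  fixes G :: "'a ugraph"
  defines "H \<equiv> octahedral_replacement G"
  defines "D \<equiv> \<lambda>a. real (vertex_degree H (Old a))"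
  assumes G: "finite_simple_graph G"
  shows "(\<Sum>d\<in>edges H. 1 / sqrt (\<Prod>p\<in>d. real (vertex_degree H p))) =
    (\<Sum>e\<in>edges G. 1 / sqrt (\<Prod>a\<in>e. D a))
    + 3 / 4 * real (card (triangles G))
    + (\<Sum>T\<in>triangles G. \<Sum>a\<in>T. 1 / sqrt (D a))"
proof -
  let ?f = "\<lambda>d. 1 / sqrt (\<Prod>p\<in>d. real (vertex_degree H p))"
  have 1: "?f (Old ` e) = 1 / sqrt (\<Prod>a\<in>e. D a)" for e
    unfolding D_def by (subst prod.reindex) (auto simp: inj_on_def)
  have 2: "(\<Sum>d\<in>sides (sides T). ?f (New T ` d)) = 3 / 4" if T: "T \<in> triangles G" for T
  proof -
    have "?f (New T ` d) = 1 / 4" if d: "d \<in> sides (sides T)" for d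
    proof -
      obtain e e' where "d = {e, e'}" "e \<noteq> e'" "e \<in> sides T" "e' \<in> sides T"
        using d unfolding sides_def[of "sides T"] by (auto simp: card_2_iff)
      then show ?thesis using vertex_degree_New[OF G T] by (simp add: H_def)
    qed
    then show ?thesis using T by (simp add: card_sides card_triangle)
  qed
  have 3: "(\<Sum>e\<in>sides T. \<Sum>a\<in>e. ?f {New T e, Old a}) = (\<Sum>a\<in>T. 1 / sqrt (D a))"
    if T: "T \<in> triangles G" for T
  proof -
    have "?f {New T e, Old a} = 1 / 2 * (1 / sqrt (D a))" if "e \<in> sides T" for e a
      using vertex_degree_New[OF G T that] by (simp add: H_def D_def real_sqrt_mult)
    then have "(\<Sum>e\<in>sides T. \<Sum>a\<in>e. ?f {New T e, Old a}) =
        (\<Sum>e\<in>sides T. \<Sum>a\<in>e. 1 / 2 * (1 / sqrt (D a)))"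
      by (intro sum.cong refl) auto
    also have "\<dots> = (\<Sum>a\<in>T. 1 / sqrt (D a))"
      by (subst sum_sides_elements[OF card_triangle[OF T]]) (simp add: sum_divide_distrib[symmetric] sum_distrib_left)
    finally show ?thesis .
  qed
  have "(\<Sum>d\<in>edges H. ?f d) = (\<Sum>e\<in>edges G. ?f (Old ` e))
    + (\<Sum>T\<in>triangles G. \<Sum>d\<in>sides (sides T). ?f (New T ` d))
    + (\<Sum>T\<in>triangles G. \<Sum>e\<in>sides T. \<Sum>a\<in>e. ?f {New T e, Old a})"
    unfolding H_def by (rule sum_edges_octahedral_replacement[OF G])
  also have "\<dots> = (\<Sum>e\<in>edges G. 1 / sqrt (\<Prod>a\<in>e. D a))
    + (\<Sum>T\<in>triangles G. 3 / 4) + (\<Sum>T\<in>triangles G. \<Sum>a\<in>T. 1 / sqrt (D a))"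
    by (intro arg_cong2[of _ _ _ _ "(+)"] sum.cong refl 1 2 3)
  finally show ?thesis by simp
qed

section \<open>Sums over lattice points of a simplex\<close>

definition simplex :: "nat \<Rightarrow> (nat \<times> nat \<times> nat) set" where
  "simplex n = {(x, y, z). x + y + z = n}"

lemma finite_simplex: "finite (simplex n)"
proof -
  have "simplex n \<subseteq> {..n} \<times> {..n} \<times> {..n}" by (auto simp: simplex_def)
  then show ?thesis by (rule finite_subset) simp
qed

lemma sum_simplex_Suc:
  fixes f :: "nat \<times> nat \<times> nat \<Rightarrow> 'b::comm_monoid_add"
  shows "(\<Sum>p\<in>simplex (Suc n). f p) =
    (\<Sum>y\<le>Suc n. f (0, y, Suc n - y)) + (\<Sum>(x, y, z)\<in>simplex n. f (Suc x, y, z))"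
proof -
  let ?A = "(\<lambda>y. (0::nat, y, Suc n - y)) ` {..Suc n}"
  let ?B = "(\<lambda>(x, y, z). (Suc x, y, z)) ` simplex n"
  have "simplex (Suc n) = ?A \<union> ?B"
  proof (intro set_eqI iffI)
    fix p assume "p \<in> simplex (Suc n)"
    then obtain x y z where p: "p = (x, y, z)" "x + y + z = Suc n" by (auto simp: simplex_def)
    then show "p \<in> ?A \<union> ?B" by (cases x) (auto simp: simplex_def image_iff)
  qed (auto simp: simplex_def)
  moreover have "?A \<inter> ?B = {}" by auto
  moreover have "sum f ?A = (\<Sum>y\<le>Suc n. f (0, y, Suc n - y))"
    by (subst sum.reindex) (auto simp: inj_on_def)
  moreover have "sum f ?B = (\<Sum>(x, y, z)\<in>simplex n. f (Suc x, y, z))"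
    by (subst sum.reindex) (auto simp: inj_on_def o_def case_prod_beta)
  ultimately show ?thesis
    using finite_simplex[of n] by (simp add: sum.union_disjoint)
qed

text \<open>A simplex of size \<open>n + 1\<close> has three corners, \<open>n\<close> further points on each side and
  \<open>n choose 2\<close> interior points. Size 0 is excluded since its single point has all coordinates zero.
  The induction peels off the points with \<open>x = 0\<close>; on the rest, \<open>x\<close> no longer influences the
  summand, so the induction hypothesis is used for the function that ignores its first argument.\<close>

lemma sum_simplex_zero_pattern:
  fixes h :: "bool \<Rightarrow> bool \<Rightarrow> bool \<Rightarrow> real"
  shows "(\<Sum>(x, y, z)\<in>simplex (Suc n). h (x = 0) (y = 0) (z = 0)) =
    h False True True + h True False True + h True True False
    + real n * (h True False False + h False True False + h False False True)
    + real n * (real n - 1) / 2 * h False False False"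
proof (induction n arbitrary: h)
  case 0
  have "simplex (Suc 0) = {(1, 0, 0), (0, 1, 0), (0, 0, 1)}" by (auto simp: simplex_def)
  then show ?case by simp
next
  case (Suc n)
  have row: "(\<Sum>y\<le>Suc (Suc n). h True (y = 0) (Suc (Suc n) - y = 0)) =
    h True True False + h True False True + real (Suc n) * h True False False"
  proof -
    have "(\<Sum>y\<le>n. h True (Suc y = 0) (Suc (Suc n) - Suc y = 0)) = (\<Sum>y\<le>n. h True False False)"
      by (intro sum.cong refl) auto
    then show ?thesis
      by (subst sum.atMost_Suc, subst sum.atMost_Suc_shift) (simp add: algebra_simps)
  qed
  have "(\<Sum>(x, y, z)\<in>simplex (Suc (Suc n)). h (x = 0) (y = 0) (z = 0)) =
    (\<Sum>y\<le>Suc (Suc n). h True (y = 0) (Suc (Suc n) - y = 0))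
    + (\<Sum>(x, y, z)\<in>simplex (Suc n). h False (y = 0) (z = 0))"
    by (subst sum_simplex_Suc) simp
  also have "\<dots> = h True True False + h True False True + real (Suc n) * h True False False
    + (h False True True + h False False True + h False True False
    + real n * (h False False False + h False True False + h False False True)
    + real n * (real n - 1) / 2 * h False False False)"
    unfolding row Suc.IH[of "\<lambda>_. h False"] ..
  finally show ?case by (simp add: field_simps)
qed

lemma card_simplex_Suc: "real (card (simplex (Suc n))) = (real n + 2) * (real n + 3) / 2"
  using sum_simplex_zero_pattern[of "\<lambda>_ _ _. 1" n] by (simp add: field_simps)

section \<open>Edges and triangles of the triangular mesh\<close>

text \<open>Both kinds of triangles are indexed by the coordinatewise minimum of their corners, the
  base point.\<close>

fun up :: "nat \<times> nat \<times> nat \<Rightarrow> (nat \<times> nat \<times> nat) set" where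
  "up (x, y, z) = {(Suc x, y, z), (x, Suc y, z), (x, y, Suc z)}"

fun down :: "nat \<times> nat \<times> nat \<Rightarrow> (nat \<times> nat \<times> nat) set" where
  "down (x, y, z) = {(x, Suc y, Suc z), (Suc x, y, Suc z), (Suc x, Suc y, z)}"

lemma mesh_adj_iff:
  "mesh_adj (x, y, z) (x', y', z') \<longleftrightarrow>
    x = Suc x' \<and> y' = Suc y \<and> z = z' \<or> x = Suc x' \<and> y = y' \<and> z' = Suc z \<or>
    x' = Suc x \<and> y = Suc y' \<and> z = z' \<or> x = x' \<and> y = Suc y' \<and> z' = Suc z \<or>
    x' = Suc x \<and> y = y' \<and> z = Suc z' \<or> x = x' \<and> y' = Suc y \<and> z = Suc z'"
proof -
  have "int a - int b = 1 \<longleftrightarrow> a = Suc b" "int a - int b = -1 \<longleftrightarrow> b = Suc a"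
    "int a - int b = 0 \<longleftrightarrow> a = b" for a b
    by linarith+
  then show ?thesis
    unfolding mesh_adj_def by (simp only: prod.case insert_iff empty_iff prod.inject simp_thms)
qed

lemma mesh_adj_sym: "mesh_adj u v \<Longrightarrow> mesh_adj v u"
  by (cases u; cases v) (auto simp: mesh_adj_iff)

lemma verts_mesh: "verts (triangular_mesh (Suc n)) = simplex n"
  by (simp add: triangular_mesh_def simplex_def)

lemma edge_mesh_iff:
  "{u, v} \<in> edges (triangular_mesh (Suc n)) \<longleftrightarrow> u \<in> simplex n \<and> v \<in> simplex n \<and> mesh_adj u v"
proof -
  have *: "edges (triangular_mesh (Suc n)) = {{u, v} | u v. u \<in> simplex n \<and> v \<in> simplex n \<and> mesh_adj u v}"
    by (simp add: triangular_mesh_def simplex_def Let_def)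
  show ?thesis
    unfolding * mem_Collect_eq doubleton_eq_iff using mesh_adj_sym by blast
qed

lemma card_up: "card (up p) = 3"
  by (cases p) auto

lemma card_down: "card (down p) = 3"
  by (cases p) auto

text \<open>The coordinate sums over the corners recover the base point, and their residues modulo
  three tell the two orientations apart.\<close>

lemma coordinate_sums_up:
  "(\<Sum>(x, y, z)\<in>up (a, b, c). x) = 3 * a + 1"
  "(\<Sum>(x, y, z)\<in>up (a, b, c). y) = 3 * b + 1"
  "(\<Sum>(x, y, z)\<in>up (a, b, c). z) = 3 * c + 1"
  by simp_all

lemma coordinate_sums_down:
  "(\<Sum>(x, y, z)\<in>down (a, b, c). x) = 3 * a + 2"
  "(\<Sum>(x, y, z)\<in>down (a, b, c). y) = 3 * b + 2"
  "(\<Sum>(x, y, z)\<in>down (a, b, c). z) = 3 * c + 2"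
  by simp_all

lemma inj_up: "inj up"
proof (rule injI)
  fix p q assume eq: "up p = up q"
  obtain a b c a' b' c' where pq: "p = (a, b, c)" "q = (a', b', c')" by (cases p; cases q) auto
  show "p = q"
    using arg_cong[OF eq, of "\<lambda>T. \<Sum>(x, y, z)\<in>T. x"]
      arg_cong[OF eq, of "\<lambda>T. \<Sum>(x, y, z)\<in>T. y"]
      arg_cong[OF eq, of "\<lambda>T. \<Sum>(x, y, z)\<in>T. z"]
    unfolding pq coordinate_sums_up by simp
qed

lemma inj_down: "inj down"
proof (rule injI)
  fix p q assume eq: "down p = down q"
  obtain a b c a' b' c' where pq: "p = (a, b, c)" "q = (a', b', c')" by (cases p; cases q) auto
  show "p = q"
    using arg_cong[OF eq, of "\<lambda>T. \<Sum>(x, y, z)\<in>T. x"]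
      arg_cong[OF eq, of "\<lambda>T. \<Sum>(x, y, z)\<in>T. y"]
      arg_cong[OF eq, of "\<lambda>T. \<Sum>(x, y, z)\<in>T. z"]
    unfolding pq coordinate_sums_down by simp
qed

lemma up_neq_down: "up p \<noteq> down q"
proof
  assume eq: "up p = down q"
  obtain a b c a' b' c' where pq: "p = (a, b, c)" "q = (a', b', c')" by (cases p; cases q) auto
  have "3 * a + 1 = 3 * a' + 2"
    using arg_cong[OF eq, of "\<lambda>T. \<Sum>(x, y, z)\<in>T. x"]
    unfolding pq coordinate_sums_up coordinate_sums_down .
  then show False by presburger
qed

lemma sum_sides_up:
  fixes f :: "(nat \<times> nat \<times> nat) set \<Rightarrow> 'b::comm_monoid_add"
  shows "(\<Sum>e\<in>sides (up (x, y, z)). f e) =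
    f {(Suc x, y, z), (x, Suc y, z)} + f {(x, Suc y, z), (x, y, Suc z)}
    + f {(Suc x, y, z), (x, y, Suc z)}"
  unfolding up.simps by (rule sum_sides_triple) auto

lemma sides_up:
  "sides (up (x, y, z)) = {{(Suc x, y, z), (x, Suc y, z)}, {(x, Suc y, z), (x, y, Suc z)},
    {(Suc x, y, z), (x, y, Suc z)}}"
  unfolding up.simps by (rule sides_triple) auto

text \<open>A side determines its upward triangle, because the base point is the coordinatewise
  minimum of any two corners.\<close>

lemma base_of_side_up:
  assumes "e \<in> sides (up p)"
  shows "p = (Min (fst ` e), Min ((fst \<circ> snd) ` e), Min ((snd \<circ> snd) ` e))"
proof -
  obtain x y z where p: "p = (x, y, z)" by (cases p) auto
  consider "e = {(Suc x, y, z), (x, Suc y, z)}" | "e = {(x, Suc y, z), (x, y, Suc z)}"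
    | "e = {(Suc x, y, z), (x, y, Suc z)}"
    using assms unfolding p sides_up by blast
  then show ?thesis unfolding p by cases simp_all
qed

lemma sides_up_disjoint: "p \<noteq> q \<Longrightarrow> sides (up p) \<inter> sides (up q) = {}"
  by (metis base_of_side_up disjoint_iff)

text \<open>The upward triangle on an edge has the coordinatewise minimum of the two ends as its
  base point.\<close>

lemma edges_mesh:
  "edges (triangular_mesh (n + 2)) = (\<Union>p\<in>simplex n. sides (up p))"
proof (intro set_eqI iffI)
  fix e assume "e \<in> edges (triangular_mesh (n + 2))"
  then obtain u v where e: "e = {u, v}" "u \<in> simplex (Suc n)" "v \<in> simplex (Suc n)" "mesh_adj u v"
    by (auto simp: triangular_mesh_def simplex_def Let_def)
  obtain x y z x' y' z' where uv: "u = (x, y, z)" "v = (x', y', z')" by (cases u; cases v) auto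
  have "e \<in> sides (up (min x x', min y y', min z z')) \<and> (min x x', min y y', min z z') \<in> simplex n"
    using e unfolding uv mesh_adj_iff sides_up
    by (elim disjE conjE) (simp_all add: simplex_def insert_commute)
  then show "e \<in> (\<Union>p\<in>simplex n. sides (up p))" by blast
next
  fix e assume "e \<in> (\<Union>p\<in>simplex n. sides (up p))"
  then obtain p where p: "p \<in> simplex n" "e \<in> sides (up p)" by blast
  obtain x y z where xyz: "p = (x, y, z)" by (cases p) auto
  show "e \<in> edges (triangular_mesh (n + 2))"
    using p unfolding xyz sides_up
    by (elim insertE emptyE) (simp_all add: edge_mesh_iff simplex_def mesh_adj_iff)
qed

lemma sum_edges_mesh:
  fixes f :: "(nat \<times> nat \<times> nat) set \<Rightarrow> 'b::comm_monoid_add"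
  shows "(\<Sum>e\<in>edges (triangular_mesh (n + 2)). f e) = (\<Sum>p\<in>simplex n. \<Sum>e\<in>sides (up p). f e)"
  unfolding edges_mesh
proof (rule sum.UNION_disjoint)
  show "\<forall>p\<in>simplex n. finite (sides (up p))"
    by (auto intro!: finite_sides)
  show "\<forall>p\<in>simplex n. \<forall>q\<in>simplex n. p \<noteq> q \<longrightarrow> sides (up p) \<inter> sides (up q) = {}"
    using sides_up_disjoint by blast
qed (rule finite_simplex)

lemma up_subset: "p \<in> simplex n \<Longrightarrow> up p \<subseteq> simplex (Suc n)"
  by (cases p) (auto simp: simplex_def)

lemma down_subset: "p \<in> simplex n \<Longrightarrow> down p \<subseteq> simplex (n + 2)"
  by (cases p) (auto simp: simplex_def)

lemma mesh_adj_up: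
  assumes "a \<in> up p" "b \<in> up p" "a \<noteq> b"
  shows "mesh_adj a b"
proof -
  obtain x y z where p: "p = (x, y, z)" by (cases p) auto
  show ?thesis using assms unfolding p up.simps
    by (elim insertE emptyE) (simp_all add: mesh_adj_iff)
qed

lemma mesh_adj_down:
  assumes "a \<in> down p" "b \<in> down p" "a \<noteq> b"
  shows "mesh_adj a b"
proof -
  obtain x y z where p: "p = (x, y, z)" by (cases p) auto
  show ?thesis using assms unfolding p down.simps
    by (elim insertE emptyE) (simp_all add: mesh_adj_iff)
qed

text \<open>An edge has at most two common neighbours, one on each side of it: the third corner of
  its upward triangle and, if the edge does not lie on the boundary, the third corner of its
  downward triangle.\<close>

lemma common_neighbour:
  assumes "mesh_adj a c" "mesh_adj b c"
  shows "a = (Suc x, y, z) \<Longrightarrow> b = (x, Suc y, z) \<Longrightarrow>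
      c = (x, y, Suc z) \<or> (\<exists>k. z = Suc k \<and> c = (Suc x, Suc y, k))"
    and "a = (x, Suc y, z) \<Longrightarrow> b = (x, y, Suc z) \<Longrightarrow>
      c = (Suc x, y, z) \<or> (\<exists>k. x = Suc k \<and> c = (k, Suc y, Suc z))"
    and "a = (Suc x, y, z) \<Longrightarrow> b = (x, y, Suc z) \<Longrightarrow>
      c = (x, Suc y, z) \<or> (\<exists>k. y = Suc k \<and> c = (Suc x, k, Suc z))"
proof -
  obtain i j k where c: "c = (i, j, k)" by (cases c) auto
  show "c = (x, y, Suc z) \<or> (\<exists>k. z = Suc k \<and> c = (Suc x, Suc y, k))"
    if "a = (Suc x, y, z)" "b = (x, Suc y, z)"
    using assms unfolding that c mesh_adj_iff by (elim disjE conjE) simp_all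
  show "c = (Suc x, y, z) \<or> (\<exists>k. x = Suc k \<and> c = (k, Suc y, Suc z))"
    if "a = (x, Suc y, z)" "b = (x, y, Suc z)"
    using assms unfolding that c mesh_adj_iff by (elim disjE conjE) simp_all
  show "c = (x, Suc y, z) \<or> (\<exists>k. y = Suc k \<and> c = (Suc x, k, Suc z))"
    if "a = (Suc x, y, z)" "b = (x, y, Suc z)"
    using assms unfolding that c mesh_adj_iff by (elim disjE conjE) simp_all
qed

lemma up_or_down:
  assumes "{a, b} \<in> sides (up p)" "mesh_adj a c" "mesh_adj b c"
  shows "{a, b, c} = up p \<or> (\<exists>q. {a, b, c} = down q)"
proof -
  obtain x y z where p: "p = (x, y, z)" by (cases p) auto
  have case_ab: "{a, b, c} = up p \<or> (\<exists>q. {a, b, c} = down q)"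
    if adj: "mesh_adj a c" "mesh_adj b c" and
      ab: "a = (Suc x, y, z) \<and> b = (x, Suc y, z) \<or> a = (x, Suc y, z) \<and> b = (x, y, Suc z)
        \<or> a = (Suc x, y, z) \<and> b = (x, y, Suc z)" for a b
    using ab
  proof (elim disjE conjE)
    assume ab: "a = (Suc x, y, z)" "b = (x, Suc y, z)"
    from common_neighbour(1)[OF adj ab] show ?thesis
    proof (elim disjE exE conjE)
      fix k assume "z = Suc k" "c = (Suc x, Suc y, k)"
      then have "{a, b, c} = down (x, y, k)" by (simp add: ab insert_commute)
      then show ?thesis by blast
    qed (simp add: ab p)
  next
    assume ab: "a = (x, Suc y, z)" "b = (x, y, Suc z)"
    from common_neighbour(2)[OF adj ab] show ?thesis
    proof (elim disjE exE conjE)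
      fix k assume "x = Suc k" "c = (k, Suc y, Suc z)"
      then have "{a, b, c} = down (k, y, z)" by (simp add: ab insert_commute)
      then show ?thesis by blast
    qed (simp add: ab p insert_commute)
  next
    assume ab: "a = (Suc x, y, z)" "b = (x, y, Suc z)"
    from common_neighbour(3)[OF adj ab] show ?thesis
    proof (elim disjE exE conjE)
      fix k assume "y = Suc k" "c = (Suc x, k, Suc z)"
      then have "{a, b, c} = down (x, k, z)" by (simp add: ab insert_commute)
      then show ?thesis by blast
    qed (simp add: ab p insert_commute)
  qed
  from assms(1) consider
      "a = (Suc x, y, z) \<and> b = (x, Suc y, z) \<or> a = (x, Suc y, z) \<and> b = (x, y, Suc z)
        \<or> a = (Suc x, y, z) \<and> b = (x, y, Suc z)"
    | "b = (Suc x, y, z) \<and> a = (x, Suc y, z) \<or> b = (x, Suc y, z) \<and> a = (x, y, Suc z)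
        \<or> b = (Suc x, y, z) \<and> a = (x, y, Suc z)"
    unfolding p sides_up insert_iff empty_iff doubleton_eq_iff by blast
  then show ?thesis
    using case_ab[OF assms(2,3)] case_ab[OF assms(3,2)] by cases (simp_all only: insert_commute)
qed

lemma triangles_mesh:
  "triangles (triangular_mesh (n + 3)) = up ` simplex (Suc n) \<union> down ` simplex n"
proof (intro set_eqI iffI)
  have mesh: "triangular_mesh (n + 3) = triangular_mesh (Suc n + 2)" by (simp add: numeral_3_eq_3)
  have mesh': "triangular_mesh (n + 3) = triangular_mesh (Suc (n + 2))" by (simp add: numeral_3_eq_3)
  {
    fix T assume T: "T \<in> triangles (triangular_mesh (n + 3))"
    from card_triangle[OF T] obtain a b c
      where abc: "T = {a, b, c}" "a \<noteq> b" "b \<noteq> c" "a \<noteq> c" by (rule card_3_obtain)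
    have edge: "{a, b} \<in> edges (triangular_mesh (n + 3))" "{b, c} \<in> edges (triangular_mesh (n + 3))"
      "{a, c} \<in> edges (triangular_mesh (n + 3))"
      using T abc by (auto simp: triangles_def)
    have adj: "mesh_adj b c" "mesh_adj a c"
      using edge unfolding mesh' edge_mesh_iff by auto
    have sub: "T \<subseteq> simplex (n + 2)"
      using T unfolding triangles_def mesh' verts_mesh by blast
    obtain p where p: "p \<in> simplex (Suc n)" "{a, b} \<in> sides (up p)"
      using edge(1) unfolding mesh edges_mesh by blast
    from up_or_down[OF p(2) adj(2,1)] show "T \<in> up ` simplex (Suc n) \<union> down ` simplex n"
    proof (elim disjE exE)
      fix q assume q: "{a, b, c} = down q"
      then have "down q \<subseteq> simplex (n + 2)" using sub abc(1) by simp
      then have "q \<in> simplex n" by (cases q) (simp add: simplex_def)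
      then show ?thesis using q abc(1) by blast
    qed (use p(1) abc(1) in blast)
  next
    fix T assume "T \<in> up ` simplex (Suc n) \<union> down ` simplex n"
    then have "T \<subseteq> simplex (n + 2) \<and> card T = 3 \<and> (\<forall>a\<in>T. \<forall>b\<in>T. a \<noteq> b \<longrightarrow> mesh_adj a b)"
    proof (elim UnE imageE)
      fix p assume "T = up p" "p \<in> simplex (Suc n)"
      then show ?thesis using up_subset[of p "Suc n"] card_up mesh_adj_up by simp
    next
      fix p assume "T = down p" "p \<in> simplex n"
      then show ?thesis using down_subset[of p n] card_down mesh_adj_down by simp
    qed
    then show "T \<in> triangles (triangular_mesh (n + 3))"
      unfolding triangles_def mesh' edge_mesh_iff verts_mesh by blast
  }
qed

lemma sum_triangles_mesh:
  fixes f :: "(nat \<times> nat \<times> nat) set \<Rightarrow> 'b::comm_monoid_add"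
  shows "(\<Sum>T\<in>triangles (triangular_mesh (n + 3)). f T) =
    (\<Sum>p\<in>simplex (Suc n). f (up p)) + (\<Sum>p\<in>simplex n. f (down p))"
proof -
  have "up ` simplex (Suc n) \<inter> down ` simplex n = {}" using up_neq_down by blast
  then show ?thesis
    unfolding triangles_mesh
    by (simp add: sum.union_disjoint finite_simplex sum.reindex inj_on_subset[OF inj_up]
        inj_on_subset[OF inj_down])
qed

section \<open>Degrees in the derived network\<close>

text \<open>A counting device for the lemmas below: the condition \<open>P\<close> pins down the point \<open>p\<close>, which
  exists exactly when \<open>b\<close> holds.\<close>

lemma sum_simplex_point:
  assumes "\<And>q. q \<in> simplex n \<Longrightarrow> P q \<longleftrightarrow> q = p \<and> b" "b \<Longrightarrow> p \<in> simplex n"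
  shows "(\<Sum>q\<in>simplex n. of_bool (P q)) = (of_bool b :: nat)"
proof -
  have "(\<Sum>q\<in>simplex n. of_bool (P q)) = (\<Sum>q\<in>simplex n. if q = p then of_bool b else 0 :: nat)"
    by (intro sum.cong refl) (simp add: assms(1))
  also have "\<dots> = of_bool b" using assms(2) finite_simplex by (auto simp: sum.delta)
  finally show ?thesis .
qed

text \<open>A vertex lies on the upward triangle based one step below it in a given coordinate
  direction, provided this coordinate is positive, and on the downward triangle based one step
  below it in two given directions, provided both coordinates are positive.\<close>

lemma count_up:
  assumes "(x, y, z) \<in> simplex (Suc n)"
  shows "(\<Sum>p\<in>simplex n. of_bool ((x, y, z) \<in> up p)) =
    (of_bool (x \<noteq> 0) + of_bool (y \<noteq> 0) + of_bool (z \<noteq> 0) :: nat)"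
proof -
  have "(\<Sum>p\<in>simplex n. of_bool ((x, y, z) \<in> up p)) =
     (\<Sum>(x', y', z')\<in>simplex n. of_bool (x = Suc x' \<and> y = y' \<and> z = z'))
   + (\<Sum>(x', y', z')\<in>simplex n. of_bool (x = x' \<and> y = Suc y' \<and> z = z'))
   + (\<Sum>(x', y', z')\<in>simplex n. of_bool (x = x' \<and> y = y' \<and> z = Suc z') :: nat)"
    unfolding sum.distrib[symmetric] by (intro sum.cong refl) auto
  also have "(\<Sum>(x', y', z')\<in>simplex n. of_bool (x = Suc x' \<and> y = y' \<and> z = z')) =
      (of_bool (x \<noteq> 0) :: nat)"
    unfolding case_prod_beta
    by (rule sum_simplex_point[where p = "(x - 1, y, z)"]) (use assms in \<open>auto simp: simplex_def\<close>)
  also have "(\<Sum>(x', y', z')\<in>simplex n. of_bool (x = x' \<and> y = Suc y' \<and> z = z')) =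
      (of_bool (y \<noteq> 0) :: nat)"
    unfolding case_prod_beta
    by (rule sum_simplex_point[where p = "(x, y - 1, z)"]) (use assms in \<open>auto simp: simplex_def\<close>)
  also have "(\<Sum>(x', y', z')\<in>simplex n. of_bool (x = x' \<and> y = y' \<and> z = Suc z')) =
      (of_bool (z \<noteq> 0) :: nat)"
    unfolding case_prod_beta
    by (rule sum_simplex_point[where p = "(x, y, z - 1)"]) (use assms in \<open>auto simp: simplex_def\<close>)
  finally show ?thesis .
qed

lemma count_down:
  assumes "(x, y, z) \<in> simplex (n + 2)"
  shows "(\<Sum>p\<in>simplex n. of_bool ((x, y, z) \<in> down p)) =
    (of_bool (y \<noteq> 0 \<and> z \<noteq> 0) + of_bool (x \<noteq> 0 \<and> z \<noteq> 0) + of_bool (x \<noteq> 0 \<and> y \<noteq> 0) :: nat)"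
proof -
  have "(\<Sum>p\<in>simplex n. of_bool ((x, y, z) \<in> down p)) =
     (\<Sum>(x', y', z')\<in>simplex n. of_bool (x = x' \<and> y = Suc y' \<and> z = Suc z'))
   + (\<Sum>(x', y', z')\<in>simplex n. of_bool (x = Suc x' \<and> y = y' \<and> z = Suc z'))
   + (\<Sum>(x', y', z')\<in>simplex n. of_bool (x = Suc x' \<and> y = Suc y' \<and> z = z') :: nat)"
    unfolding sum.distrib[symmetric] by (intro sum.cong refl) auto
  also have "(\<Sum>(x', y', z')\<in>simplex n. of_bool (x = x' \<and> y = Suc y' \<and> z = Suc z')) =
      (of_bool (y \<noteq> 0 \<and> z \<noteq> 0) :: nat)"
    unfolding case_prod_beta
    by (rule sum_simplex_point[where p = "(x, y - 1, z - 1)"]) (use assms in \<open>auto simp: simplex_def\<close>)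
  also have "(\<Sum>(x', y', z')\<in>simplex n. of_bool (x = Suc x' \<and> y = y' \<and> z = Suc z')) =
      (of_bool (x \<noteq> 0 \<and> z \<noteq> 0) :: nat)"
    unfolding case_prod_beta
    by (rule sum_simplex_point[where p = "(x - 1, y, z - 1)"]) (use assms in \<open>auto simp: simplex_def\<close>)
  also have "(\<Sum>(x', y', z')\<in>simplex n. of_bool (x = Suc x' \<and> y = Suc y' \<and> z = z')) =
      (of_bool (x \<noteq> 0 \<and> y \<noteq> 0) :: nat)"
    unfolding case_prod_beta
    by (rule sum_simplex_point[where p = "(x - 1, y - 1, z)"]) (use assms in \<open>auto simp: simplex_def\<close>)
  finally show ?thesis .
qed

text \<open>The edges are the sides of the upward triangles, each belonging to only one, and a corner
  lies on two sides of its triangle.\<close>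

lemma vertex_degree_mesh:
  "vertex_degree (triangular_mesh (n + 2)) a = 2 * (\<Sum>p\<in>simplex n. of_bool (a \<in> up p))"
proof -
  have *: "(\<Sum>e\<in>sides (up p). of_bool (a \<in> e)) = 2 * (of_bool (a \<in> up p) :: nat)" for p
  proof -
    have "finite (up p)" by (cases p) simp
    have "(\<Sum>e\<in>sides (up p). of_bool (a \<in> e)) = (\<Sum>e\<in>sides (up p). \<Sum>b\<in>e. of_bool (b = a) :: nat)"
      by (intro sum.cong refl) (simp add: sum_of_bool_eq sides_finite_mem)
    then show ?thesis
      using \<open>finite (up p)\<close> by (simp add: sum_sides_elements card_up sum_of_bool_eq)
  qed
  show ?thesis
    unfolding vertex_degree_eq_sum[OF finite_simple_graph_triangular_mesh] sum_edges_mesh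
      sum_distrib_left * ..
qed

text \<open>The arguments say which of the three coordinates vanish: the values belong to interior
  points, to points inside a side and to corners. The last equation also covers three vanishing
  coordinates, which does not happen for vertices of a mesh of dimension at least two.\<close>

fun old_degree :: "bool \<Rightarrow> bool \<Rightarrow> bool \<Rightarrow> real" where
  "old_degree False False False = 18"
| "old_degree True False False = 10"
| "old_degree False True False = 10"
| "old_degree False False True = 10"
| "old_degree _ _ _ = 4"

lemma vertex_degree_THDN3_Old:
  assumes "(x, y, z) \<in> simplex (n + 2)"
  shows "real (vertex_degree (THDN3 (n + 3)) (Old (x, y, z))) = old_degree (x = 0) (y = 0) (z = 0)"
proof -
  have s: "(x, y, z) \<in> simplex (Suc (Suc n))" using assms by simp
  have nz: "\<not> (x = 0 \<and> y = 0 \<and> z = 0)" using assms by (auto simp: simplex_def)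
  have m: "triangular_mesh (n + 3) = triangular_mesh (Suc n + 2)" by (simp add: eval_nat_numeral)
  have "vertex_degree (triangular_mesh (n + 3)) (x, y, z) =
     2 * (of_bool (x \<noteq> 0) + of_bool (y \<noteq> 0) + of_bool (z \<noteq> 0))"
    unfolding m vertex_degree_mesh count_up[OF s] ..
  then have "vertex_degree (THDN3 (n + 3)) (Old (x, y, z)) =
     4 * (of_bool (x \<noteq> 0) + of_bool (y \<noteq> 0) + of_bool (z \<noteq> 0)) +
     2 * (of_bool (y \<noteq> 0 \<and> z \<noteq> 0) + of_bool (x \<noteq> 0 \<and> z \<noteq> 0) + of_bool (x \<noteq> 0 \<and> y \<noteq> 0))"
    unfolding THDN3_def vertex_degree_Old[OF finite_simple_graph_triangular_mesh]
      sum_triangles_mesh count_up[OF s] count_down[OF assms] by simp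
  then show ?thesis using nz by (cases "x = 0"; cases "y = 0"; cases "z = 0") auto
qed

section \<open>The Balaban index\<close>

lemma card_edges_mesh:
  "real (card (edges (triangular_mesh (n + 3)))) = 3 * (real n + 2) * (real n + 3) / 2"
proof -
  have m: "n + 3 = Suc n + 2" by simp
  have "card (edges (triangular_mesh (n + 3))) = (\<Sum>p\<in>simplex (Suc n). card (sides (up p)))"
    unfolding m using sum_edges_mesh[of "\<lambda>_. 1::nat" "Suc n"] by simp
  then show ?thesis by (simp add: card_sides card_up card_simplex_Suc)
qed

lemma card_triangles_mesh:
  "card (triangles (triangular_mesh (n + 3))) = card (simplex (Suc n)) + card (simplex n)"
  using sum_triangles_mesh[of "\<lambda>_. 1::nat" n] by simp

lemma inverse_sqrts:
  "1 / sqrt 40 = sqrt 10 / 20" "1 / sqrt 72 = sqrt 2 / 12" "1 / sqrt 180 = sqrt 5 / 30"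
  "1 / sqrt 10 = sqrt 10 / 10" "1 / sqrt 18 = sqrt 2 / 6"
  "sqrt 100 = 10" "sqrt 324 = 18" "sqrt 16 = 4" "sqrt 4 = 2"
proof -
  have "sqrt 40 = 2 * sqrt 10" "sqrt 72 = 6 * sqrt 2" "sqrt 180 = 6 * sqrt 5" "sqrt 18 = 3 * sqrt 2"
    by (auto intro!: real_sqrt_unique simp: power_mult_distrib)
  then show "1 / sqrt 40 = sqrt 10 / 20" "1 / sqrt 72 = sqrt 2 / 12" "1 / sqrt 180 = sqrt 5 / 30"
    "1 / sqrt 10 = sqrt 10 / 10" "1 / sqrt 18 = sqrt 2 / 6"
    by (auto simp: field_simps)
qed (auto intro!: real_sqrt_unique)

text \<open>The ends of an edge of the upward triangle based at \<open>(x, y, z)\<close> arise by raising a single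
  coordinate, so their degrees only depend on which of \<open>x\<close>, \<open>y\<close>, \<open>z\<close> vanish. The result lists the
  six edges at the corners, the edges between boundary points, those from the boundary to the
  interior, and the interior ones.\<close>

lemma sum_mesh_edges_weight:
  "(\<Sum>e\<in>edges (triangular_mesh (n + 4)).
      1 / sqrt (\<Prod>a\<in>e. real (vertex_degree (THDN3 (n + 4)) (Old a)))) =
    6 * (sqrt 10 / 20) + 3 * (real n + 2) / 10
    + 6 * (real n + 1) * (sqrt 5 / 30) + 3 * (real n + 1) * real n / 2 / 18"
proof -
  let ?D = "\<lambda>a. real (vertex_degree (THDN3 (n + 4)) (Old a))"
  let ?g = old_degree
  have m: "triangular_mesh (n + 4) = triangular_mesh (Suc (Suc n) + 2)" by (simp add: eval_nat_numeral)
  have D: "?D (x, y, z) = ?g (x = 0) (y = 0) (z = 0)" if "(x, y, z) \<in> simplex (n + 3)" for x y z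
    using vertex_degree_THDN3_Old[of x y z "Suc n"] that by (simp add: eval_nat_numeral)
  define h where "h a b c = 1 / sqrt (?g False b c * ?g a False c)
      + 1 / sqrt (?g a False c * ?g a b False) + 1 / sqrt (?g False b c * ?g a b False)" for a b c
  have "(\<Sum>e\<in>edges (triangular_mesh (n + 4)). 1 / sqrt (\<Prod>a\<in>e. ?D a)) =
      (\<Sum>p\<in>simplex (Suc (Suc n)). \<Sum>e\<in>sides (up p). 1 / sqrt (\<Prod>a\<in>e. ?D a))"
    unfolding m by (rule sum_edges_mesh)
  also have "\<dots> = (\<Sum>(x, y, z)\<in>simplex (Suc (Suc n)). h (x = 0) (y = 0) (z = 0))"
  proof (rule sum.cong[OF refl], clarify)
    fix x y z assume "(x, y, z) \<in> simplex (Suc (Suc n))"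
    then have "(Suc x, y, z) \<in> simplex (n + 3)" "(x, Suc y, z) \<in> simplex (n + 3)"
      "(x, y, Suc z) \<in> simplex (n + 3)" by (auto simp: simplex_def)
    then show "(\<Sum>e\<in>sides (up (x, y, z)). 1 / sqrt (\<Prod>a\<in>e. ?D a)) = h (x = 0) (y = 0) (z = 0)"
      unfolding sum_sides_up by (simp add: D h_def)
  qed
  also have "\<dots> = 6 * (1 / sqrt 40) + 3 * (real n + 2) / 10
    + 6 * (real n + 1) * (1 / sqrt 180) + 3 * (real n + 1) * real n / 2 / 18"
    unfolding sum_simplex_zero_pattern unfolding h_def by (simp add: inverse_sqrts field_simps)
  finally show ?thesis unfolding inverse_sqrts .
qed

text \<open>For dimension \<open>n + 4\<close> the base points of the downward triangles form a simplex of
  size \<open>n + 1\<close>. This is where dimension at least four enters: the count by zero patterns needs a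
  simplex of positive size.\<close>

lemma sum_mesh_triangles_weight:
  "(\<Sum>T\<in>triangles (triangular_mesh (n + 4)).
      \<Sum>a\<in>T. 1 / sqrt (real (vertex_degree (THDN3 (n + 4)) (Old a)))) =
    3 / 2 + 9 * (real n + 2) * (sqrt 10 / 10)
    + 3 * (real n + 2) * (real n + 1) * (sqrt 2 / 6)"
proof -
  let ?D = "\<lambda>a. real (vertex_degree (THDN3 (n + 4)) (Old a))"
  let ?g = old_degree
  have m: "triangular_mesh (n + 4) = triangular_mesh (Suc n + 3)" by (simp add: eval_nat_numeral)
  have D: "?D (x, y, z) = ?g (x = 0) (y = 0) (z = 0)" if "(x, y, z) \<in> simplex (n + 3)" for x y z
    using vertex_degree_THDN3_Old[of x y z "Suc n"] that by (simp add: eval_nat_numeral)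
  define h where "h a b c = 1 / sqrt (?g False b c) + 1 / sqrt (?g a False c)
      + 1 / sqrt (?g a b False)" for a b c
  define k where "k a b c = 1 / sqrt (?g a False False) + 1 / sqrt (?g False b False)
      + 1 / sqrt (?g False False c)" for a b c
  have "(\<Sum>T\<in>triangles (triangular_mesh (n + 4)). \<Sum>a\<in>T. 1 / sqrt (?D a)) =
      (\<Sum>p\<in>simplex (Suc (Suc n)). \<Sum>a\<in>up p. 1 / sqrt (?D a))
    + (\<Sum>p\<in>simplex (Suc n). \<Sum>a\<in>down p. 1 / sqrt (?D a))"
    unfolding m by (rule sum_triangles_mesh)
  also have "(\<Sum>p\<in>simplex (Suc (Suc n)). \<Sum>a\<in>up p. 1 / sqrt (?D a)) =
      (\<Sum>(x, y, z)\<in>simplex (Suc (Suc n)). h (x = 0) (y = 0) (z = 0))"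
  proof (rule sum.cong[OF refl], clarify)
    fix x y z assume "(x, y, z) \<in> simplex (Suc (Suc n))"
    then have "(Suc x, y, z) \<in> simplex (n + 3)" "(x, Suc y, z) \<in> simplex (n + 3)"
      "(x, y, Suc z) \<in> simplex (n + 3)" by (auto simp: simplex_def)
    then show "(\<Sum>a\<in>up (x, y, z). 1 / sqrt (?D a)) = h (x = 0) (y = 0) (z = 0)"
      by (simp add: D h_def)
  qed
  also have "(\<Sum>p\<in>simplex (Suc n). \<Sum>a\<in>down p. 1 / sqrt (?D a)) =
      (\<Sum>(x, y, z)\<in>simplex (Suc n). k (x = 0) (y = 0) (z = 0))"
  proof (rule sum.cong[OF refl], clarify)
    fix x y z assume "(x, y, z) \<in> simplex (Suc n)"
    then have "(x, Suc y, Suc z) \<in> simplex (n + 3)" "(Suc x, y, Suc z) \<in> simplex (n + 3)"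
      "(Suc x, Suc y, z) \<in> simplex (n + 3)" by (auto simp: simplex_def)
    then show "(\<Sum>a\<in>down (x, y, z). 1 / sqrt (?D a)) = k (x = 0) (y = 0) (z = 0)"
      by (simp add: D k_def)
  qed
  finally show ?thesis
    unfolding sum_simplex_zero_pattern unfolding h_def k_def by (simp add: inverse_sqrts field_simps)
qed

theorem theorem2p2p2:
  fixes r :: nat
  assumes "r \<ge> 4"
  shows "balaban_index (THDN3 r) =
    (6 - 13 * real r + 7 * (real r)\<^sup>2) / (40 * (8 - 14 * real r + 7 * (real r)\<^sup>2)) *
    (159 + 180 * sqrt 2 - 36 * sqrt 5 - 90 * sqrt 10
      + (- 107 - 150 * sqrt 2 + 12 * sqrt 5 + 54 * sqrt 10) * real r
      + 10 * (5 + 3 * sqrt 2) * (real r)\<^sup>2)"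
proof -
  obtain n where r: "r = n + 4" using assms by (metis add.commute le_Suc_ex)
  let ?M = "triangular_mesh r"
  have fin: "finite_simple_graph ?M" by (rule finite_simple_graph_triangular_mesh)
  have m: "n + 4 = Suc n + 3" "n + 4 = Suc (n + 3)" by simp_all
  have tri: "real (card (triangles ?M)) = (real r - 1)\<^sup>2"
    unfolding r m(1) card_triangles_mesh
    by (simp add: card_simplex_Suc power2_eq_square field_simps)
  have edg: "real (card (edges ?M)) = 3 * real r * (real r - 1) / 2"
    unfolding r m(1) card_edges_mesh by (simp add: field_simps)
  have vrt: "real (card (verts ?M)) = real r * (real r + 1) / 2"
    unfolding r m(2) verts_mesh
    using card_simplex_Suc[of "n + 2"] by (simp add: numeral_3_eq_3 field_simps)
  have E: "real (card (edges (THDN3 r))) = 3 / 2 * (6 - 13 * real r + 7 * (real r)\<^sup>2)"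
    unfolding THDN3_def card_edges_octahedral_replacement[OF fin]
    by (simp add: tri edg power2_eq_square field_simps)
  have V: "real (card (edges (THDN3 r))) - real (card (verts (THDN3 r))) + 2 =
      8 - 14 * real r + 7 * (real r)\<^sup>2"
    unfolding E unfolding THDN3_def card_verts_octahedral_replacement[OF fin]
    by (simp add: tri vrt power2_eq_square field_simps)
  have n: "real n = real r - 4" by (simp add: r)
  have "(\<Sum>d\<in>edges (THDN3 r). 1 / sqrt (\<Prod>p\<in>d. real (vertex_degree (THDN3 r) p))) =
     6 * (sqrt 10 / 20) + 3 * (real n + 2) / 10
    + 6 * (real n + 1) * (sqrt 5 / 30) + 3 * (real n + 1) * real n / 2 / 18
    + 3 / 4 * (real r - 1)\<^sup>2
    + (3 / 2 + 9 * (real n + 2) * (sqrt 10 / 10)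
    + 3 * (real n + 2) * (real n + 1) * (sqrt 2 / 6))"
    using edge_weight_octahedral_replacement[OF fin] sum_mesh_edges_weight[of n]
      sum_mesh_triangles_weight[of n]
    unfolding THDN3_def[symmetric] tri r[symmetric] by simp
  also have "\<dots> = 1 / 60 * (159 + 180 * sqrt 2 - 36 * sqrt 5 - 90 * sqrt 10
      + (- 107 - 150 * sqrt 2 + 12 * sqrt 5 + 54 * sqrt 10) * real r
      + 10 * (5 + 3 * sqrt 2) * (real r)\<^sup>2)"
    unfolding n by (simp add: power2_eq_square field_simps)
  finally have S: "(\<Sum>d\<in>edges (THDN3 r). 1 / sqrt (\<Prod>p\<in>d. real (vertex_degree (THDN3 r) p))) =
    1 / 60 * (159 + 180 * sqrt 2 - 36 * sqrt 5 - 90 * sqrt 10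
      + (- 107 - 150 * sqrt 2 + 12 * sqrt 5 + 54 * sqrt 10) * real r
      + 10 * (5 + 3 * sqrt 2) * (real r)\<^sup>2)" .
  have "3 / 2 * A / B * (1 / 60 * P) = A / (40 * B) * P" for A B P :: real
    by (cases "B = 0") (simp_all add: field_simps)
  then show ?thesis
    unfolding balaban_index_def V S unfolding E .
qed

end
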